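(* Let $n\ge 1$, let $A$ be an $n\times n$ matrix with real entries, and let $T>0$ be a real number with $\Vert A\Vert_2\le T$. Then $$|\mathrm{perm}(A)|\le T^{n}(n+6)\exp\left[\frac{-\sqrt{n(1-h_\infty(A)/T)}}{400}\right].$$
   Context: The permanent is $\mathrm{perm}(A)=\sum_{\sigma\in S_n}\prod_{i=1}^n a_{i,\sigma(i)}$. $\Vert A\Vert_2$ is the operator 2-norm of $A$. For a matrix $A$ with rows $r_1,\dots,r_n$, $h_\infty(A)=\frac1n\sum_{i=1}^n\Vert r_i\Vert_\infty$, where $\Vert r_i\Vert_\infty$ is the maximum absolute value of an entry of $r_i$. *)

theory Defs
  imports "HOL-Analysis.Analysis"
begin

definition perm :: "'a::comm_ring_1^'n^'n \<Rightarrow> 'a" where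
  "perm A = (\<Sum>\<sigma> | \<sigma> permutes (UNIV :: 'n set). \<Prod>i\<in>UNIV. A $ i $ \<sigma> i)"

definition h_inf :: "real^'n^'n \<Rightarrow> real" where
  "h_inf A = (1 / real CARD('n)) * (\<Sum>i\<in>UNIV. infnorm (row i A))"

end

theory Submission
  imports Defs
begin

text \<open>After scaling, \<open>T = 1\<close>, and \<open>A\<close> may be complex. By a version of Glynn's formula, \<open>perm A\<close>
  is the average of \<open>\<Prod>j. cnj (x $ j)\<close> times \<open>\<Prod>i. (A *v x) $ i\<close> over vectors \<open>x\<close> of \<open>m\<close>-th roots
  of unity, and \<open>t \<le> exp (t - 1)\<close> bounds the modulus of the integrand by \<open>exp (- G x / 2)\<close>, where
  the deficit \<open>G x = 2 * (\<Sum>i. 1 - cmod ((A *v x) $ i))\<close> is nonnegative.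

  For a contraction, \<open>G x\<close> is a minimum of squared distances from \<open>x\<close>, each shifted by a
  nonnegative constant, so the discrete gradient of \<open>sqrt (G + 1)\<close> is bounded when \<open>m\<close> is large
  compared with \<open>n\<close>. The Poincare inequality on the product of cyclic groups, applied to
  \<open>exp (- l * sqrt (G + 1) / 2)\<close> for \<open>l\<close>, \<open>l / 2\<close>, \<open>l / 4\<close>, \<dots>, then gives exponential
  concentration of \<open>sqrt (G + 1)\<close> about its mean.

  The mean of \<open>G\<close> is at least \<open>n * (1 - h_inf A) / 9\<close>: an even sextic majorant of the modulus
  reduces the mean of \<open>cmod ((A *v x) $ i)\<close> to the second, fourth and sixth moments of a linear
  form in independent roots of unity, which are explicit.\<close>

section \<open>Averages over finite sets\<close>

definition avg :: "'a set \<Rightarrow> ('a \<Rightarrow> 'b::real_normed_field) \<Rightarrow> 'b" where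
  "avg X f = (\<Sum>x\<in>X. f x) / of_nat (card X)"

lemma avg_cong: "(\<And>x. x \<in> X \<Longrightarrow> f x = g x) \<Longrightarrow> avg X f = avg X g"
  unfolding avg_def by (metis (mono_tags, lifting) sum.cong)

lemma avg_const: "finite X \<Longrightarrow> X \<noteq> {} \<Longrightarrow> avg X (\<lambda>x. c) = c"
  by (simp add: avg_def)

lemma avg_add: "avg X (\<lambda>x. f x + g x) = avg X f + avg X g"
  by (simp add: avg_def sum.distrib add_divide_distrib)

lemma avg_diff: "avg X (\<lambda>x. f x - g x) = avg X f - avg X g"
  by (simp add: avg_def sum_subtractf diff_divide_distrib)

lemma avg_cmult: "avg X (\<lambda>x. c * f x) = c * avg X f"
  by (simp add: avg_def sum_distrib_left)

lemma avg_sum: "avg X (\<lambda>x. \<Sum>i\<in>I. f i x) = (\<Sum>i\<in>I. avg X (f i))"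
  unfolding avg_def by (subst sum.swap) (simp add: sum_divide_distrib)

lemma avg_swap: "avg X (\<lambda>x. avg Y (f x)) = avg Y (\<lambda>y. avg X (\<lambda>x. f x y))"
  unfolding avg_def sum_divide_distrib[symmetric] by (subst sum.swap) (simp add: mult.commute)

lemma avg_bij_betw: "bij_betw T X X \<Longrightarrow> avg X (\<lambda>x. f (T x)) = avg X f"
  unfolding avg_def using sum.reindex_bij_betw by metis

lemma norm_avg_le: "norm (avg X f) \<le> avg X (\<lambda>x. norm (f x))"
  unfolding avg_def by (simp add: norm_divide divide_right_mono norm_sum)

lemma avg_mono:
  fixes f g :: "'a \<Rightarrow> real"
  shows "(\<And>x. x \<in> X \<Longrightarrow> f x \<le> g x) \<Longrightarrow> avg X f \<le> avg X g"
  unfolding avg_def by (intro divide_right_mono sum_mono) auto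

lemma avg_nonneg:
  fixes f :: "'a \<Rightarrow> real"
  shows "(\<And>x. x \<in> X \<Longrightarrow> 0 \<le> f x) \<Longrightarrow> 0 \<le> avg X f"
  unfolding avg_def by (intro divide_nonneg_nonneg sum_nonneg) auto

lemma power2_avg_le:
  fixes f :: "'a \<Rightarrow> real"
  shows "(avg X f)\<^sup>2 \<le> avg X (\<lambda>x. (f x)\<^sup>2)"
proof (cases "card X = 0")
  case False
  then show ?thesis
    using sum_squared_le_sum_of_squares[of f X]
    by (simp add: avg_def power_divide power2_eq_square field_simps)
qed (simp add: avg_def)

definition variance :: "'a set \<Rightarrow> ('a \<Rightarrow> real) \<Rightarrow> real" where
  "variance X f = avg X (\<lambda>x. (f x)\<^sup>2) - (avg X f)\<^sup>2"

lemma root_mean_square_le_avg_plus: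
  assumes "\<And>x. x \<in> X \<Longrightarrow> 0 \<le> f x" and "0 \<le> \<sigma>" and "variance X f \<le> \<sigma>\<^sup>2"
  shows "sqrt (avg X (\<lambda>x. (f x)\<^sup>2)) \<le> avg X f + \<sigma>"
proof (rule real_le_lsqrt)
  show "0 \<le> avg X f + \<sigma>" using assms(1,2) by (intro add_nonneg_nonneg avg_nonneg)
  have "0 \<le> avg X f * \<sigma>" using assms(1,2) by (intro mult_nonneg_nonneg avg_nonneg)
  then show "avg X (\<lambda>x. (f x)\<^sup>2) \<le> (avg X f + \<sigma>)\<^sup>2"
    using assms(3) by (simp add: variance_def power2_sum)
qed

section \<open>A Poincare inequality for commuting cyclic maps\<close>

lemma sum_squares_le_cube: "(\<Sum>d<m. (real d)\<^sup>2) \<le> real m ^ 3 / 3"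
  by (induction m) (auto simp: power2_eq_square power3_eq_cube field_simps)

locale commuting_cyclic_maps =
  fixes X :: "'a set" and T :: "'i::finite \<Rightarrow> 'a \<Rightarrow> 'a" and m :: nat
  assumes finite_X: "finite X" and X_nonempty: "X \<noteq> {}" and m_pos: "m > 0"
    and bij: "bij_betw (T i) X X"
    and period: "x \<in> X \<Longrightarrow> (T i ^^ m) x = x"
    and commute: "x \<in> X \<Longrightarrow> T i (T j x) = T j (T i x)"
    and transitive: "(\<And>i x. x \<in> X \<Longrightarrow> f (T i x) = f x) \<Longrightarrow> x \<in> X \<Longrightarrow> y \<in> X \<Longrightarrow> f x = (f y :: real)"
begin

lemma funpow_in: "x \<in> X \<Longrightarrow> (T i ^^ d) x \<in> X"
  using bij_betwE[OF bij_betw_funpow[OF bij]] by blast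

lemma avg_funpow: "avg X (\<lambda>x. f ((T i ^^ d) x)) = avg X f"
  by (rule avg_bij_betw[OF bij_betw_funpow[OF bij]])

lemma funpow_commute:
  assumes "x \<in> X"
  shows "(T j ^^ d) (T i x) = T i ((T j ^^ d) x)"
proof (induction d)
  case (Suc d)
  then show ?case using commute[OF funpow_in[OF assms]] by simp
qed simp

definition orbit_avg :: "'i \<Rightarrow> ('a \<Rightarrow> real) \<Rightarrow> 'a \<Rightarrow> real" where
  "orbit_avg i f x = avg {..<m} (\<lambda>d. f ((T i ^^ d) x))"

definition energy :: "'i \<Rightarrow> ('a \<Rightarrow> real) \<Rightarrow> real" where
  "energy i f = avg X (\<lambda>x. (f (T i x) - f x)\<^sup>2)"

lemma avg_const_period: "avg {..<m} (\<lambda>d. c) = (c :: real)"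
  using m_pos by (intro avg_const) auto

lemma avg_orbit_avg: "avg X (orbit_avg i f) = avg X f"
  unfolding orbit_avg_def by (subst avg_swap) (simp add: avg_funpow avg_const_period)

lemma orbit_avg_T:
  assumes "x \<in> X"
  shows "orbit_avg i f (T i x) = orbit_avg i f x"
proof -
  have "(\<Sum>d<m. f ((T i ^^ d) (T i x))) = (\<Sum>d<m. f ((T i ^^ Suc d) x))"
    by (simp add: funpow_swap1)
  also have "\<dots> = (\<Sum>d<m. f ((T i ^^ d) x))"
    using sum.lessThan_Suc_shift[of "\<lambda>d. f ((T i ^^ d) x)" m]
      sum.lessThan_Suc[of "\<lambda>d. f ((T i ^^ d) x)" m] period[OF assms] by simp
  finally show ?thesis by (simp add: orbit_avg_def avg_def)
qed

lemma orbit_avg_funpow: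
  assumes "x \<in> X"
  shows "orbit_avg i f ((T i ^^ d) x) = orbit_avg i f x"
proof (induction d)
  case (Suc d)
  then show ?case using orbit_avg_T[OF funpow_in[OF assms]] by simp
qed simp

lemma orbit_avg_other_T:
  "x \<in> X \<Longrightarrow> orbit_avg j f (T i x) = avg {..<m} (\<lambda>d. f (T i ((T j ^^ d) x)))"
  by (simp add: orbit_avg_def funpow_commute)

lemma avg_mult_orbit_avg: "avg X (\<lambda>x. orbit_avg i f x * f x) = avg X (\<lambda>x. (orbit_avg i f x)\<^sup>2)"
proof -
  have "avg X (\<lambda>x. orbit_avg i f x * f x) = avg X (\<lambda>x. orbit_avg i f x * f ((T i ^^ d) x))" for d
    by (subst avg_funpow[where i = i and d = d, symmetric])
      (intro avg_cong, simp add: orbit_avg_funpow)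
  then have "avg X (\<lambda>x. orbit_avg i f x * f x)
      = avg {..<m} (\<lambda>d. avg X (\<lambda>x. orbit_avg i f x * f ((T i ^^ d) x)))"
    by (metis (no_types, lifting) avg_cong avg_const_period)
  also have "\<dots> = avg X (\<lambda>x. orbit_avg i f x * avg {..<m} (\<lambda>d. f ((T i ^^ d) x)))"
    by (subst avg_swap) (simp only: avg_cmult)
  finally show ?thesis by (simp only: power2_eq_square flip: orbit_avg_def)
qed

lemma avg_square_diff_funpow_le:
  "avg X (\<lambda>x. (f ((T i ^^ d) x) - f x)\<^sup>2) \<le> (real d)\<^sup>2 * energy i f"
proof -
  let ?D = "\<lambda>x. f (T i x) - f x"
  have "(f ((T i ^^ d) x) - f x)\<^sup>2 \<le> real d * (\<Sum>k<d. (?D ((T i ^^ k) x))\<^sup>2)" for x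
  proof -
    have "f ((T i ^^ d) x) - f x = (\<Sum>k<d. ?D ((T i ^^ k) x))"
      using sum_lessThan_telescope[of "\<lambda>k. f ((T i ^^ k) x)" d] by simp
    then show ?thesis
      using sum_squared_le_sum_of_squares[of "\<lambda>k. ?D ((T i ^^ k) x)" "{..<d}"]
      by (simp add: mult.commute)
  qed
  then have "avg X (\<lambda>x. (f ((T i ^^ d) x) - f x)\<^sup>2)
      \<le> avg X (\<lambda>x. real d * (\<Sum>k<d. (?D ((T i ^^ k) x))\<^sup>2))"
    by (rule avg_mono)
  also have "\<dots> = real d * (\<Sum>k<d. avg X (\<lambda>x. (?D ((T i ^^ k) x))\<^sup>2))"
    by (simp only: avg_cmult avg_sum)
  also have "\<dots> = (real d)\<^sup>2 * energy i f"
    using avg_funpow[where i = i and f = "\<lambda>x. (?D x)\<^sup>2"]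
    by (simp add: energy_def power2_eq_square)
  finally show ?thesis .
qed

lemma avg_square_diff_orbit_avg_le:
  "avg X (\<lambda>x. (f x - orbit_avg i f x)\<^sup>2) \<le> (real m)\<^sup>2 / 3 * energy i f"
proof -
  have "(f x - orbit_avg i f x)\<^sup>2 \<le> avg {..<m} (\<lambda>d. (f ((T i ^^ d) x) - f x)\<^sup>2)" for x
    using power2_avg_le[of "{..<m}" "\<lambda>d. f ((T i ^^ d) x) - f x"]
    by (simp add: avg_diff avg_const_period orbit_avg_def power2_commute)
  then have "avg X (\<lambda>x. (f x - orbit_avg i f x)\<^sup>2)
      \<le> avg X (\<lambda>x. avg {..<m} (\<lambda>d. (f ((T i ^^ d) x) - f x)\<^sup>2))"
    by (rule avg_mono)
  also have "\<dots> = avg {..<m} (\<lambda>d. avg X (\<lambda>x. (f ((T i ^^ d) x) - f x)\<^sup>2))"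
    by (rule avg_swap)
  also have "\<dots> \<le> avg {..<m} (\<lambda>d. (real d)\<^sup>2 * energy i f)"
    by (intro avg_mono avg_square_diff_funpow_le)
  also have "\<dots> = (\<Sum>d<m. (real d)\<^sup>2) / real m * energy i f"
    by (simp add: avg_def flip: sum_distrib_right)
  also have "\<dots> \<le> (real m ^ 3 / 3) / real m * energy i f"
    unfolding energy_def
    by (intro mult_right_mono divide_right_mono sum_squares_le_cube avg_nonneg) auto
  also have "\<dots> = (real m)\<^sup>2 / 3 * energy i f"
    using m_pos by (simp add: power2_eq_square power3_eq_cube)
  finally show ?thesis .
qed

lemma variance_le_variance_orbit_avg:
  "variance X f \<le> variance X (orbit_avg i f) + (real m)\<^sup>2 / 3 * energy i f"
proof -
  let ?P = "orbit_avg i f"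
  have "avg X (\<lambda>x. (f x - ?P x)\<^sup>2) = avg X (\<lambda>x. ((f x)\<^sup>2 + (?P x)\<^sup>2) - 2 * (?P x * f x))"
    by (simp add: power2_diff mult_ac)
  also have "\<dots> = avg X (\<lambda>x. (f x)\<^sup>2) - avg X (\<lambda>x. (?P x)\<^sup>2)"
    by (simp only: avg_add avg_diff avg_cmult avg_mult_orbit_avg)
  finally have "avg X (\<lambda>x. (f x)\<^sup>2) - avg X (\<lambda>x. (?P x)\<^sup>2) \<le> (real m)\<^sup>2 / 3 * energy i f"
    using avg_square_diff_orbit_avg_le[of f i] by simp
  then show ?thesis by (simp add: variance_def avg_orbit_avg)
qed

lemma energy_orbit_avg_le: "energy i (orbit_avg j f) \<le> energy i f"
proof -
  let ?D = "\<lambda>x. f (T i x) - f x"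
  have "energy i (orbit_avg j f) \<le> avg X (\<lambda>x. avg {..<m} (\<lambda>d. (?D ((T j ^^ d) x))\<^sup>2))"
    unfolding energy_def
  proof (rule avg_mono)
    fix x assume "x \<in> X"
    then have "orbit_avg j f (T i x) - orbit_avg j f x = avg {..<m} (\<lambda>d. ?D ((T j ^^ d) x))"
      by (simp add: orbit_avg_other_T avg_diff) (simp add: orbit_avg_def)
    then show "(orbit_avg j f (T i x) - orbit_avg j f x)\<^sup>2
        \<le> avg {..<m} (\<lambda>d. (?D ((T j ^^ d) x))\<^sup>2)"
      using power2_avg_le[of "{..<m}" "\<lambda>d. ?D ((T j ^^ d) x)"] by simp
  qed
  also have "\<dots> = energy i f"
    unfolding energy_def
    by (subst avg_swap) (simp add: avg_funpow[of "\<lambda>x. (?D x)\<^sup>2"] avg_const_period)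
  finally show ?thesis .
qed

lemma variance_le_sum_energy_if_invariant:
  assumes "finite J" and "\<And>i x. i \<notin> J \<Longrightarrow> x \<in> X \<Longrightarrow> f (T i x) = f x"
  shows "variance X f \<le> (real m)\<^sup>2 / 3 * (\<Sum>i\<in>J. energy i f)"
  using assms
proof (induction J arbitrary: f rule: finite_induct)
  case empty
  obtain z where "z \<in> X" using X_nonempty by blast
  then have "f x = f z" if "x \<in> X" for x using transitive[of f x z] empty that by blast
  then have "avg X f = f z" and "avg X (\<lambda>x. (f x)\<^sup>2) = (f z)\<^sup>2"
    using avg_cong[of X f "\<lambda>_. f z"] avg_cong[of X "\<lambda>x. (f x)\<^sup>2" "\<lambda>_. (f z)\<^sup>2"]
    by (simp_all add: avg_const finite_X X_nonempty)
  then show ?case by (simp add: variance_def)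
next
  case (insert j J)
  have "orbit_avg j f (T i x) = orbit_avg j f x" if "i \<notin> J" "x \<in> X" for i x
  proof (cases "i = j")
    case False
    with that insert.prems show ?thesis
      by (simp add: orbit_avg_other_T[OF that(2)] funpow_in) (simp add: orbit_avg_def)
  qed (simp add: orbit_avg_T that)
  then have "variance X (orbit_avg j f) \<le> (real m)\<^sup>2 / 3 * (\<Sum>i\<in>J. energy i (orbit_avg j f))"
    by (rule insert.IH)
  also have "\<dots> \<le> (real m)\<^sup>2 / 3 * (\<Sum>i\<in>J. energy i f)"
    by (intro mult_left_mono sum_mono energy_orbit_avg_le) simp
  finally show ?case
    using variance_le_variance_orbit_avg[of f j] insert.hyps by (simp add: distrib_left)
qed

theorem poincare_inequality: "variance X f \<le> (real m)\<^sup>2 / 3 * (\<Sum>i\<in>UNIV. energy i f)"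
  by (rule variance_le_sum_energy_if_invariant) auto

end

section \<open>Exponential concentration\<close>

lemma le_exp_mult_square_if_diff_le:
  fixes u v s :: real
  assumes "u - v\<^sup>2 \<le> s * u" and "0 \<le> u" and "0 \<le> s" "s \<le> 1 / 2"
  shows "u \<le> v\<^sup>2 * exp (2 * s)"
proof -
  have "1 \<le> (1 - s) * (1 + 2 * s)"
    using assms(3,4) mult_nonneg_nonneg[of s "1 / 2 - s"] by (simp add: algebra_simps)
  also have "\<dots> \<le> (1 - s) * exp (2 * s)"
    using assms(4) by (intro mult_left_mono exp_ge_add_one_self) auto
  finally have "u \<le> u * ((1 - s) * exp (2 * s))"
    using assms(2) mult_left_mono[of 1 _ u] by simp
  also have "\<dots> = (u - s * u) * exp (2 * s)" by (simp add: algebra_simps)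
  also have "\<dots> \<le> v\<^sup>2 * exp (2 * s)" using assms(1) by (intro mult_right_mono) auto
  finally show ?thesis .
qed

text \<open>Each halving of \<open>l\<close> takes a square root of the bound to be proved, so the errors
  \<open>2 * c * l\<^sup>2\<close> add up to a geometric series, while the second-order term \<open>M * l\<^sup>2\<close> of the base
  estimate is divided by \<open>2 ^ N\<close>.\<close>

lemma le_exp_by_halving:
  fixes u :: "real \<Rightarrow> real"
  assumes nonneg: "\<And>l. 0 \<le> u l"
    and base: "\<And>l. 0 < l \<Longrightarrow> u l \<le> exp (- l * b + M * l\<^sup>2)"
    and halve: "\<And>l. 0 < l \<Longrightarrow> l \<le> L \<Longrightarrow> u l - (u (l / 2))\<^sup>2 \<le> c * l\<^sup>2 * u l"
    and c_bounds: "0 \<le> c" "c * L\<^sup>2 \<le> 1 / 2" and l_bounds: "0 < l" "l \<le> L"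
  shows "u l \<le> exp (- l * b + 4 * c * l\<^sup>2)"
proof -
  have approx: "u l \<le> exp (- l * b + 4 * c * l\<^sup>2 + M * l\<^sup>2 / 2 ^ N)" if "0 < l" "l \<le> L" for l N
    using that
  proof (induction N arbitrary: l)
    case 0
    have "u l \<le> exp (- l * b + M * l\<^sup>2)" using 0 by (intro base)
    also have "\<dots> \<le> exp (- l * b + 4 * c * l\<^sup>2 + M * l\<^sup>2 / 2 ^ 0)" using c_bounds(1) by simp
    finally show ?case .
  next
    case (Suc N)
    have "c * l\<^sup>2 \<le> c * L\<^sup>2" using Suc.prems c_bounds(1) by (intro mult_left_mono power_mono) auto
    then have "u l \<le> (u (l / 2))\<^sup>2 * exp (2 * (c * l\<^sup>2))"
      using halve[OF Suc.prems] nonneg c_bounds by (intro le_exp_mult_square_if_diff_le) auto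
    also have "\<dots> \<le> (exp (- (l / 2) * b + 4 * c * (l / 2)\<^sup>2 + M * (l / 2)\<^sup>2 / 2 ^ N))\<^sup>2
        * exp (2 * (c * l\<^sup>2))"
      using Suc.prems by (intro mult_right_mono power_mono Suc.IH nonneg) auto
    also have "\<dots> = exp (- l * b + 4 * c * l\<^sup>2 + M * l\<^sup>2 / 2 ^ Suc N)"
      by (simp add: power2_eq_square flip: exp_add)
    finally show ?case .
  qed
  have "(\<lambda>N. exp (- l * b + 4 * c * l\<^sup>2 + M * l\<^sup>2 * (1 / 2) ^ N))
      \<longlonglongrightarrow> exp (- l * b + 4 * c * l\<^sup>2 + M * l\<^sup>2 * 0)"
    by (intro tendsto_intros LIMSEQ_realpow_zero) auto
  then show ?thesis
    using approx[OF l_bounds] by (intro LIMSEQ_le_const) (auto simp: power_one_over field_simps)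
qed

lemma exp_minus_le_quadratic:
  fixes t :: real
  assumes "0 \<le> t"
  shows "exp (- t) \<le> 1 - t + t\<^sup>2"
proof -
  have "exp (- t) * (1 + t) \<le> exp (- t) * exp t"
    by (intro mult_left_mono exp_ge_add_one_self) simp
  also have "\<dots> \<le> 1 + t ^ 3" using assms by (simp flip: exp_add)
  also have "\<dots> = (1 - t + t\<^sup>2) * (1 + t)"
    by (simp add: power2_eq_square power3_eq_cube algebra_simps)
  finally show ?thesis using assms by (simp add: mult_le_cancel_right)
qed

lemma avg_exp_le_quadratic:
  fixes g :: "'a \<Rightarrow> real"
  assumes finite_nonempty: "finite X" "X \<noteq> {}"
    and g_nonneg: "\<And>x. x \<in> X \<Longrightarrow> 0 \<le> g x" and "0 \<le> l"
  shows "avg X (\<lambda>x. exp (- l * g x)) \<le> exp (- l * avg X g + avg X (\<lambda>x. (g x)\<^sup>2) * l\<^sup>2)"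
proof -
  have "avg X (\<lambda>x. exp (- l * g x)) \<le> avg X (\<lambda>x. (1 - l * g x) + l\<^sup>2 * (g x)\<^sup>2)"
  proof (rule avg_mono)
    fix x assume "x \<in> X"
    then show "exp (- l * g x) \<le> (1 - l * g x) + l\<^sup>2 * (g x)\<^sup>2"
      using exp_minus_le_quadratic[of "l * g x"] g_nonneg \<open>0 \<le> l\<close>
      by (simp add: power_mult_distrib)
  qed
  also have "\<dots> = 1 + (- l * avg X g + avg X (\<lambda>x. (g x)\<^sup>2) * l\<^sup>2)"
    by (simp add: avg_add avg_diff avg_cmult avg_const[OF finite_nonempty])
  also have "\<dots> \<le> exp (- l * avg X g + avg X (\<lambda>x. (g x)\<^sup>2) * l\<^sup>2)"
    by (rule exp_ge_add_one_self)
  finally show ?thesis .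
qed

lemma square_diff_exp_le:
  fixes a b l :: real
  assumes "a \<le> b" and "0 \<le> l"
  shows "(exp (- (l / 2) * b) - exp (- (l / 2) * a))\<^sup>2 \<le> l\<^sup>2 / 4 * exp (- l * a) * (b - a)\<^sup>2"
proof -
  define s where "s = l / 2 * (b - a)"
  have "0 \<le> s" using assms by (simp add: s_def)
  then have "(1 - exp (- s))\<^sup>2 \<le> s\<^sup>2"
    using exp_ge_add_one_self[of "- s"] by (intro power_mono) auto
  then have contract: "(exp (- s) - 1)\<^sup>2 \<le> s\<^sup>2" by (simp add: power2_commute)
  have "exp (- (l / 2) * b) = exp (- (l / 2) * a) * exp (- s)"
    by (simp add: s_def field_simps flip: exp_add)
  then have "(exp (- (l / 2) * b) - exp (- (l / 2) * a))\<^sup>2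
      = (exp (- (l / 2) * a) * (exp (- s) - 1))\<^sup>2"
    by (simp add: right_diff_distrib)
  also have "\<dots> = exp (- l * a) * (exp (- s) - 1)\<^sup>2"
    by (simp add: power_mult_distrib flip: exp_double)
  also have "\<dots> \<le> exp (- l * a) * s\<^sup>2" using contract by (intro mult_left_mono) auto
  also have "\<dots> = l\<^sup>2 / 4 * exp (- l * a) * (b - a)\<^sup>2"
    by (simp add: s_def power_mult_distrib power_divide)
  finally show ?thesis .
qed

context commuting_cyclic_maps
begin

definition upward_gradient_square :: "('a \<Rightarrow> real) \<Rightarrow> 'a \<Rightarrow> real" where
  "upward_gradient_square g x =
    (\<Sum>i\<in>UNIV. (max 0 (g (T i x) - g x))\<^sup>2 + (max 0 (g ((T i ^^ (m - 1)) x) - g x))\<^sup>2)"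

text \<open>The square of the increment of \<open>\<psi> \<circ> g\<close> along an edge is charged to the endpoint at which \<open>g\<close>
  is smaller, because only upward increments of \<open>g\<close> are controlled.\<close>

lemma sum_energy_comp_le:
  fixes \<psi> W :: "real \<Rightarrow> real"
  assumes W_nonneg: "\<And>a. 0 \<le> W a"
    and \<psi>_increment_le: "\<And>a b. a \<le> b \<Longrightarrow> (\<psi> b - \<psi> a)\<^sup>2 \<le> W a * (b - a)\<^sup>2"
  shows "(\<Sum>i\<in>UNIV. energy i (\<lambda>x. \<psi> (g x))) \<le> avg X (\<lambda>x. W (g x) * upward_gradient_square g x)"
proof -
  define charge where "charge S x = W (g x) * (max 0 (g (S x) - g x))\<^sup>2" for S x
  have charge_nonneg: "0 \<le> charge S x" for S x unfolding charge_def by (simp add: W_nonneg)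
  have edge: "(\<psi> (g (T i x)) - \<psi> (g x))\<^sup>2 \<le> charge (T i) x + charge (T i ^^ (m - 1)) (T i x)"
    if "x \<in> X" for i x
  proof (cases "g x \<le> g (T i x)")
    case True
    then show ?thesis
      using \<psi>_increment_le[OF True] charge_nonneg[of "T i ^^ (m - 1)" "T i x"]
      by (simp add: charge_def)
  next
    case False
    have "(T i ^^ (m - 1)) (T i x) = x"
      using period[OF that] m_pos by (cases m) (simp_all add: funpow_swap1)
    then show ?thesis
      using False \<psi>_increment_le[of "g (T i x)" "g x"] charge_nonneg[of "T i" x]
      by (simp add: charge_def power2_commute)
  qed
  have "energy i (\<lambda>x. \<psi> (g x)) \<le> avg X (charge (T i)) + avg X (charge (T i ^^ (m - 1)))" for i
  proof -
    have "energy i (\<lambda>x. \<psi> (g x)) \<le> avg X (\<lambda>x. charge (T i) x + charge (T i ^^ (m - 1)) (T i x))"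
      unfolding energy_def by (intro avg_mono edge)
    then show ?thesis unfolding avg_add by (simp add: avg_bij_betw[OF bij])
  qed
  then have "(\<Sum>i\<in>UNIV. energy i (\<lambda>x. \<psi> (g x)))
      \<le> (\<Sum>i\<in>UNIV. avg X (charge (T i)) + avg X (charge (T i ^^ (m - 1))))"
    by (rule sum_mono)
  also have "\<dots> = avg X (\<lambda>x. W (g x) * upward_gradient_square g x)"
    by (simp add: upward_gradient_square_def charge_def sum_distrib_left distrib_left
        flip: avg_add avg_sum)
  finally show ?thesis .
qed

lemma variance_comp_le:
  fixes \<psi> W :: "real \<Rightarrow> real"
  assumes gradient_le: "\<And>x. x \<in> X \<Longrightarrow> (real m)\<^sup>2 / 3 * upward_gradient_square g x \<le> C"
    and W_nonneg: "\<And>a. 0 \<le> W a"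
    and \<psi>_increment_le: "\<And>a b. a \<le> b \<Longrightarrow> (\<psi> b - \<psi> a)\<^sup>2 \<le> W a * (b - a)\<^sup>2"
  shows "variance X (\<lambda>x. \<psi> (g x)) \<le> C * avg X (\<lambda>x. W (g x))"
proof -
  have "variance X (\<lambda>x. \<psi> (g x)) \<le> (real m)\<^sup>2 / 3 * (\<Sum>i\<in>UNIV. energy i (\<lambda>x. \<psi> (g x)))"
    by (rule poincare_inequality)
  also have "\<dots> \<le> (real m)\<^sup>2 / 3 * avg X (\<lambda>x. W (g x) * upward_gradient_square g x)"
    using W_nonneg \<psi>_increment_le by (intro mult_left_mono sum_energy_comp_le) auto
  also have "\<dots> = avg X (\<lambda>x. (real m)\<^sup>2 / 3 * upward_gradient_square g x * W (g x))"
    by (simp add: mult_ac flip: avg_cmult)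
  also have "\<dots> \<le> avg X (\<lambda>x. C * W (g x))"
    by (intro avg_mono mult_right_mono gradient_le W_nonneg)
  finally show ?thesis by (simp only: avg_cmult)
qed

lemma variance_le:
  assumes "\<And>x. x \<in> X \<Longrightarrow> (real m)\<^sup>2 / 3 * upward_gradient_square g x \<le> C"
  shows "variance X g \<le> C"
  using variance_comp_le[OF assms, of "\<lambda>_. 1" "\<lambda>a. a"]
  by (simp add: avg_const finite_X X_nonempty)

lemma variance_exp_le:
  assumes gradient_le: "\<And>x. x \<in> X \<Longrightarrow> (real m)\<^sup>2 / 3 * upward_gradient_square g x \<le> C"
    and "0 \<le> l"
  shows "variance X (\<lambda>x. exp (- (l / 2) * g x)) \<le> C / 4 * l\<^sup>2 * avg X (\<lambda>x. exp (- l * g x))"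
proof -
  have "variance X (\<lambda>x. exp (- (l / 2) * g x)) \<le> C * avg X (\<lambda>x. l\<^sup>2 / 4 * exp (- l * g x))"
    using \<open>0 \<le> l\<close> by (intro variance_comp_le[OF gradient_le] square_diff_exp_le) auto
  then show ?thesis by (simp only: avg_cmult)
qed

theorem avg_exp_le:
  assumes gradient_le: "\<And>x. x \<in> X \<Longrightarrow> (real m)\<^sup>2 / 3 * upward_gradient_square g x \<le> C"
    and g_nonneg: "\<And>x. x \<in> X \<Longrightarrow> 0 \<le> g x" and l_bounds: "0 < l" "C * l\<^sup>2 \<le> 2"
  shows "avg X (\<lambda>x. exp (- l * g x)) \<le> exp (- l * avg X g + C * l\<^sup>2)"
proof -
  have "avg X (\<lambda>x. exp (- l * g x)) \<le> exp (- l * avg X g + 4 * (C / 4) * l\<^sup>2)"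
  proof (rule le_exp_by_halving[where L = l and M = "avg X (\<lambda>x. (g x)\<^sup>2)"])
    show "0 \<le> avg X (\<lambda>x. exp (- k * g x))" for k by (rule avg_nonneg) simp
    show "avg X (\<lambda>x. exp (- k * g x)) \<le> exp (- k * avg X g + avg X (\<lambda>x. (g x)\<^sup>2) * k\<^sup>2)"
      if "0 < k" for k
      using that g_nonneg by (intro avg_exp_le_quadratic finite_X X_nonempty) auto
    have "(exp (- (k / 2) * r))\<^sup>2 = exp (- k * r)" for k r :: real
      by (simp add: power2_eq_square flip: exp_add)
    then show "avg X (\<lambda>x. exp (- k * g x)) - (avg X (\<lambda>x. exp (- (k / 2) * g x)))\<^sup>2
        \<le> C / 4 * k\<^sup>2 * avg X (\<lambda>x. exp (- k * g x))" if "0 < k" for k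
      using variance_exp_le[OF gradient_le, of k] that by (simp only: variance_def less_imp_le)
    obtain z where "z \<in> X" using X_nonempty by blast
    have "0 \<le> (real m)\<^sup>2 / 3 * upward_gradient_square g z"
      by (simp add: upward_gradient_square_def sum_nonneg)
    then show "0 \<le> C / 4" using gradient_le[OF \<open>z \<in> X\<close>] by simp
  qed (use l_bounds in auto)
  then show ?thesis by simp
qed

end

section \<open>The grid of vectors of roots of unity\<close>

definition torus :: "(complex^'n) set" where
  "torus = {x. \<forall>i. cmod (x $ i) = 1}"

definition root_grid :: "nat \<Rightarrow> (complex^'n) set" where
  "root_grid m = {x. x ^ m = 1}"

definition rotation :: "complex \<Rightarrow> 'n \<Rightarrow> complex^'n" where
  "rotation w j = (\<chi> i. if i = j then w else 1)"

lemma power_vec_component: "((x :: 'a::comm_semiring_1^'n) ^ k) $ i = (x $ i) ^ k"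
  by (induction k) simp_all

lemma root_grid_iff: "x \<in> root_grid m \<longleftrightarrow> (\<forall>i. (x $ i) ^ m = 1)"
  by (simp add: root_grid_def vec_eq_iff power_vec_component)

lemma root_grid_subset_torus: "m > 0 \<Longrightarrow> root_grid m \<subseteq> torus"
  using power_eq_1_iff by (fastforce simp: torus_def root_grid_iff)

lemma mult_mem_torus: "x \<in> torus \<Longrightarrow> y \<in> torus \<Longrightarrow> x * y \<in> torus"
  by (simp add: torus_def norm_mult)

lemma mult_mem_root_grid: "x \<in> root_grid m \<Longrightarrow> y \<in> root_grid m \<Longrightarrow> x * y \<in> root_grid m"
  by (simp add: root_grid_def power_mult_distrib)

lemma power_mem_root_grid: "x \<in> root_grid m \<Longrightarrow> x ^ d \<in> root_grid m"
  by (simp add: root_grid_def) (metis mult.commute power_mult power_one)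

lemma rotation_mem_torus: "cmod w = 1 \<Longrightarrow> rotation w j \<in> torus"
  by (simp add: torus_def rotation_def)

lemma rotation_mem_root_grid: "w ^ m = 1 \<Longrightarrow> rotation w j \<in> root_grid m"
  by (simp add: root_grid_iff rotation_def)

lemma power_rotation: "rotation w j ^ d = rotation (w ^ d) j"
  by (simp add: vec_eq_iff power_vec_component rotation_def)

lemma finite_root_grid:
  assumes "m > 0"
  shows "finite (root_grid m :: (complex^'n) set)"
proof (rule finite_imageD)
  have "finite {z :: complex. z ^ m = 1}"
    using card_complex_roots_unity[of m] assms by (intro card_ge_0_finite) simp
  then have "finite (PiE (UNIV :: 'n set) (\<lambda>_. {z :: complex. z ^ m = 1}))"
    by (intro finite_PiE) auto
  then show "finite (vec_nth ` (root_grid m :: (complex^'n) set))"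
    by (rule rev_finite_subset) (auto simp: root_grid_iff)
qed (simp add: inj_on_def vec_nth_inject)

lemma root_grid_nonempty: "root_grid m \<noteq> {}"
  unfolding root_grid_def using power_one by blast

lemma avg_root_grid_const: "m > 0 \<Longrightarrow> avg (root_grid m :: (complex^'n) set) (\<lambda>x. c) = c"
  by (intro avg_const finite_root_grid root_grid_nonempty)

lemma bij_betw_root_grid_mult:
  assumes "c \<in> root_grid m" "m > 0"
  shows "bij_betw ((*) c) (root_grid m) (root_grid m)"
proof -
  let ?c' = "c ^ (m - 1)"
  have "c * ?c' = 1"
    using assms power_Suc[of c "m - 1"] by (simp add: root_grid_def)
  then have "?c' * (c * x) = x" "c * (?c' * x) = x" for x
    by (metis mult.assoc mult.commute mult_1)+
  then show ?thesis
    using assms(1) power_mem_root_grid[OF assms(1), of "m - 1"]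
    by (intro bij_betw_byWitness[where f' = "(*) ?c'"])
      (auto intro: mult_mem_root_grid simp del: One_nat_def)
qed

definition unity_root :: "nat \<Rightarrow> complex" where
  "unity_root m = cis (2 * pi / real m)"

lemma cmod_unity_root: "cmod (unity_root m) = 1"
  by (simp add: unity_root_def)

lemma unity_root_power: "m > 0 \<Longrightarrow> unity_root m ^ m = 1"
  by (simp add: unity_root_def Complex.DeMoivre)

lemma unity_root_power_pred:
  assumes "m > 0"
  shows "unity_root m ^ (m - 1) = cnj (unity_root m)"
proof -
  have "unity_root m * cnj (unity_root m) = 1"
    using complex_norm_square[of "unity_root m"] by (simp add: cmod_unity_root)
  moreover have "unity_root m ^ (m - 1) * unity_root m = 1"
    using power_minus_mult[OF assms, of "unity_root m"] by (simp add: unity_root_power[OF assms])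
  ultimately show ?thesis by (metis mult.assoc mult.commute mult_1)
qed

lemma root_of_unity_eq_power_unity_root:
  assumes "z ^ m = 1" "m > 0"
  obtains d where "z = unity_root m ^ d"
proof -
  obtain d where "z = cis (2 * pi * real d / real m)"
    using Complex.bij_betw_roots_unity[OF assms(2)] assms(1) by (auto simp: bij_betw_def)
  then have "z = unity_root m ^ d" by (simp add: unity_root_def Complex.DeMoivre mult_ac)
  then show ?thesis by (rule that)
qed

lemma unity_root_neq_1:
  assumes "m > 1"
  shows "unity_root m \<noteq> 1"
proof
  assume "unity_root m = 1"
  moreover have "inj_on (\<lambda>k. cis (2 * pi * real k / real m)) {..<m}"
    using Complex.bij_betw_roots_unity[of m] assms by (simp add: bij_betw_def)
  ultimately show False using assms inj_onD[of _ "{..<m}" 0 1] by (fastforce simp: unity_root_def)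
qed

lemma mult_cmod_unity_root_minus_1_le: "real m * cmod (unity_root m - 1) \<le> 2 * pi"
proof -
  have "cmod (unity_root m - 1) = 2 * \<bar>sin (2 * pi / real m / 2)\<bar>"
    using dist_exp_i_1[of "2 * pi / real m"] by (simp add: unity_root_def cis_conv_exp)
  also have "\<dots> \<le> 2 * \<bar>2 * pi / real m / 2\<bar>" by (intro mult_left_mono abs_sin_x_le_abs_x) simp
  finally have "cmod (unity_root m - 1) \<le> 2 * pi / real m" by simp
  then show ?thesis by (cases "m = 0") (simp_all add: field_simps)
qed

lemma rotation_invariant_imp_const:
  fixes f :: "complex^'n \<Rightarrow> 'b"
  assumes m_pos: "m > 0" and x_grid: "x \<in> root_grid m"
    and invariant: "\<And>j x. x \<in> root_grid m \<Longrightarrow> f (rotation (unity_root m) j * x) = f x"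
  shows "f x = f 1"
proof -
  have rotate: "f (rotation z j * y) = f y"
    if y_grid: "y \<in> root_grid m" and z_root: "z ^ m = 1" for z j y
  proof -
    obtain d where "z = unity_root m ^ d"
      by (rule root_of_unity_eq_power_unity_root[OF z_root m_pos])
    moreover have "f (rotation (unity_root m) j ^ d * y) = f y" for d
    proof (induction d)
      case (Suc d)
      have "rotation (unity_root m) j ^ d * y \<in> root_grid m"
        by (intro mult_mem_root_grid power_mem_root_grid rotation_mem_root_grid
            unity_root_power m_pos y_grid)
      from invariant[OF this, of j] show ?case using Suc by (simp add: mult.assoc)
    qed simp
    ultimately show ?thesis by (simp add: power_rotation)
  qed
  have "f x = f (\<chi> i. if i \<in> J then 1 else x $ i)" if "finite J" for J
    using that
  proof (induction J rule: finite_induct)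
    case empty
    then show ?case by (simp add: vec_nth_inverse)
  next
    case (insert j J)
    let ?y = "\<chi> i. if i \<in> insert j J then 1 else x $ i"
    have "f ?y = f (rotation (x $ j) j * ?y)"
      using x_grid by (intro rotate[symmetric]) (auto simp: root_grid_iff)
    also have "rotation (x $ j) j * ?y = (\<chi> i. if i \<in> J then 1 else x $ i)"
      using insert.hyps by (auto simp: vec_eq_iff rotation_def)
    finally show ?case using insert.IH by simp
  qed
  from this[OF finite[of UNIV]] show ?thesis by (simp add: one_vec_def)
qed

lemma commuting_cyclic_maps_root_grid:
  assumes m_pos: "m > 0"
  shows "commuting_cyclic_maps (root_grid m :: (complex^'n) set)
    (\<lambda>j. (*) (rotation (unity_root m) j)) m"
proof
  let ?X = "root_grid m :: (complex^'n) set" and ?w = "unity_root m"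
  show "bij_betw ((*) (rotation ?w j)) ?X ?X" for j
    by (intro bij_betw_root_grid_mult rotation_mem_root_grid unity_root_power m_pos)
  show "((*) (rotation ?w j) ^^ m) x = x" for j and x :: "complex^'n"
    using rotation_mem_root_grid[OF unity_root_power[OF m_pos], of j]
    by (simp add: funpow_times_power[of "\<lambda>_. m"] root_grid_def)
  show "f x = f y"
    if "\<And>j x. x \<in> ?X \<Longrightarrow> f (rotation ?w j * x) = f x" and "x \<in> ?X" "y \<in> ?X"
    for f :: "complex^'n \<Rightarrow> real" and x y
    using rotation_invariant_imp_const[OF m_pos _ that(1)] that(2,3) by metis
qed (auto simp: m_pos finite_root_grid root_grid_nonempty mult_ac)

section \<open>Glynn's formula\<close>

lemma avg_root_grid_eq_0_if_rotation_covariant: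
  fixes t :: "complex^'n \<Rightarrow> complex"
  assumes "m > 0" and "z \<noteq> 1" and covariant: "\<And>x. t (rotation (unity_root m) j * x) = z * t x"
  shows "avg (root_grid m) t = 0"
proof -
  have "avg (root_grid m) (\<lambda>x. t (rotation (unity_root m) j * x)) = avg (root_grid m) t"
    using \<open>m > 0\<close>
    by (intro avg_bij_betw bij_betw_root_grid_mult rotation_mem_root_grid unity_root_power) auto
  then have "(1 - z) * avg (root_grid m) t = 0"
    unfolding covariant avg_cmult by (simp add: algebra_simps)
  then show ?thesis using \<open>z \<noteq> 1\<close> by simp
qed

lemma avg_root_grid_monomial:
  fixes f :: "'n::finite \<Rightarrow> 'n"
  assumes m_gt_1: "m > 1"
  shows "avg (root_grid m) (\<lambda>x. (\<Prod>j\<in>UNIV. cnj (x $ j)) * (\<Prod>i\<in>UNIV. x $ f i))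
    = (if f permutes UNIV then 1 else 0)"
proof (cases "f permutes UNIV")
  case True
  have "(\<Prod>j\<in>UNIV. cnj (x $ j)) * (\<Prod>i\<in>UNIV. x $ f i) = 1"
    if "x \<in> root_grid m" for x :: "complex^'n"
  proof -
    have "cnj (x $ j) * x $ j = 1" for j
      using root_grid_subset_torus[of m] that m_gt_1 complex_norm_square[of "x $ j"]
      by (auto simp: torus_def mult.commute)
    moreover have "(\<Prod>i\<in>UNIV. x $ f i) = (\<Prod>i\<in>UNIV. x $ i)"
      using prod.permute[OF True, of "\<lambda>i. x $ i"] by (simp add: comp_def)
    ultimately show ?thesis by (simp flip: prod.distrib)
  qed
  with True m_gt_1 show ?thesis
    by (simp add: avg_root_grid_const cong: avg_cong)
next
  case False
  let ?w = "unity_root m"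
  have "\<not> surj f"
    using False finite_UNIV_surj_inj[OF finite, of f] bij_imp_permutes[of f UNIV]
    by (auto simp: bij_def)
  then obtain j where j_not_hit: "\<And>i. f i \<noteq> j" by (metis surjI)
  have "(\<Prod>i\<in>UNIV. cnj ((rotation ?w j * x) $ i)) = cnj ?w * (\<Prod>i\<in>UNIV. cnj (x $ i))" for x
  proof -
    have "(\<Prod>i\<in>UNIV. cnj ((rotation ?w j * x) $ i))
        = (\<Prod>i\<in>UNIV. if i = j then cnj ?w else 1) * (\<Prod>i\<in>UNIV. cnj (x $ i))"
      by (subst prod.distrib[symmetric], intro prod.cong) (auto simp: rotation_def)
    then show ?thesis by simp
  qed
  moreover have "cnj ?w \<noteq> 1"
    using unity_root_neq_1[OF m_gt_1] by (metis complex_cnj_cancel_iff complex_cnj_one)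
  ultimately have "avg (root_grid m) (\<lambda>x. (\<Prod>j\<in>UNIV. cnj (x $ j)) * (\<Prod>i\<in>UNIV. x $ f i)) = 0"
    using m_gt_1 j_not_hit
    by (intro avg_root_grid_eq_0_if_rotation_covariant[of _ "cnj ?w" _ j])
      (simp_all add: rotation_def)
  then show ?thesis using False by simp
qed

theorem glynn_formula:
  fixes A :: "complex^'n^'n"
  assumes m_gt_1: "m > 1"
  shows "perm A = avg (root_grid m) (\<lambda>x. (\<Prod>j\<in>UNIV. cnj (x $ j)) * (\<Prod>i\<in>UNIV. (A *v x) $ i))"
proof -
  have "(\<Prod>i\<in>UNIV. (A *v x) $ i) = (\<Sum>f\<in>UNIV. (\<Prod>i\<in>UNIV. A $ i $ f i) * (\<Prod>i\<in>UNIV. x $ f i))" for x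
    unfolding matrix_vector_mult_def vec_lambda_beta
    by (subst prod_sum_PiE) (auto simp: prod.distrib)
  then have "(\<Prod>j\<in>UNIV. cnj (x $ j)) * (\<Prod>i\<in>UNIV. (A *v x) $ i)
      = (\<Sum>f\<in>UNIV. (\<Prod>i\<in>UNIV. A $ i $ f i) * ((\<Prod>j\<in>UNIV. cnj (x $ j)) * (\<Prod>i\<in>UNIV. x $ f i)))" for x
    by (simp only: sum_distrib_left mult.left_commute)
  then have "avg (root_grid m) (\<lambda>x. (\<Prod>j\<in>UNIV. cnj (x $ j)) * (\<Prod>i\<in>UNIV. (A *v x) $ i))
      = (\<Sum>f\<in>UNIV. (\<Prod>i\<in>UNIV. A $ i $ f i) * (if f permutes UNIV then 1 else 0))"
    by (simp only: avg_sum avg_cmult avg_root_grid_monomial[OF m_gt_1])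
  also have "\<dots> = perm A"
    by (simp add: perm_def if_distrib sum.If_cases cong: if_cong)
  finally show ?thesis ..
qed

section \<open>The deficit of a contraction\<close>

lemma norm_matrix_vector_mult_le:
  fixes A :: "'a::{euclidean_space,real_algebra_1}^'n^'m"
  assumes "onorm ((*v) A) \<le> 1"
  shows "norm (A *v x) \<le> norm x"
  using onorm[OF matrix_vector_mul_bounded_linear, of A x] mult_right_mono[OF assms, of "norm x"]
  by simp

lemma norm_adjoint_le:
  fixes f :: "'a::euclidean_space \<Rightarrow> 'b::euclidean_space"
  assumes "linear f" and contraction: "\<And>x. norm (f x) \<le> norm x"
  shows "norm (adjoint f y) \<le> norm y"
proof -
  let ?v = "adjoint f y"
  have "norm ?v * norm ?v = inner (f ?v) y"
    by (simp add: adjoint_works[OF assms(1)] norm_eq_sqrt_inner flip: power2_eq_square)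
      (simp flip: adjoint_works[OF assms(1)])
  also have "\<dots> \<le> norm (f ?v) * norm y" by (rule norm_cauchy_schwarz)
  also have "\<dots> \<le> norm ?v * norm y" by (intro mult_right_mono contraction) simp
  finally show ?thesis by (cases "norm ?v = 0") auto
qed

lemma power2_norm_vec:
  fixes x :: "'a::real_normed_vector^'n"
  shows "(norm x)\<^sup>2 = (\<Sum>i\<in>UNIV. (norm (x $ i))\<^sup>2)"
  by (simp add: norm_vec_def L2_set_def sum_nonneg)

lemma power2_norm_torus: "x \<in> torus \<Longrightarrow> (norm (x :: complex^'n))\<^sup>2 = real CARD('n)"
  by (simp add: power2_norm_vec torus_def)

definition deficit :: "complex^'n^'n \<Rightarrow> complex^'n \<Rightarrow> real" where
  "deficit A x = 2 * (\<Sum>i\<in>UNIV. 1 - cmod ((A *v x) $ i))"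

text \<open>\<open>deficit A x\<close> is the minimum of \<open>(norm x)\<^sup>2 + (norm u)\<^sup>2 - 2 * inner (A *v x) u\<close> over
  \<open>u\<close> in the torus; completing the square turns it into a squared distance from \<open>x\<close>.\<close>

lemma complete_square_adjoint:
  fixes A :: "complex^'n^'n"
  assumes "x \<in> torus"
  shows "(norm (x - adjoint ((*v) A) u))\<^sup>2 + (real CARD('n) - (norm (adjoint ((*v) A) u))\<^sup>2)
    = 2 * (\<Sum>i\<in>UNIV. 1 - inner ((A *v x) $ i) (u $ i))"
proof -
  let ?v = "adjoint ((*v) A) u"
  have "inner x ?v = inner (A *v x) u"
    by (intro adjoint_works bounded_linear.linear matrix_vector_mul_bounded_linear)
  then have "(norm (x - ?v))\<^sup>2 - (norm ?v)\<^sup>2 = (norm x)\<^sup>2 - 2 * inner (A *v x) u"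
    by (simp add: power2_norm_eq_inner inner_diff inner_commute)
  then show ?thesis
    using power2_norm_torus[OF assms] by (simp add: inner_vec_def sum_subtractf)
qed

lemma deficit_le:
  fixes A :: "complex^'n^'n"
  assumes "x \<in> torus" and "u \<in> torus"
  shows "deficit A x \<le>
    (norm (x - adjoint ((*v) A) u))\<^sup>2 + (real CARD('n) - (norm (adjoint ((*v) A) u))\<^sup>2)"
proof -
  have "inner ((A *v x) $ i) (u $ i) \<le> cmod ((A *v x) $ i)" for i
    using norm_cauchy_schwarz[of "(A *v x) $ i" "u $ i"] assms(2) by (simp add: torus_def)
  then show ?thesis
    unfolding complete_square_adjoint[OF assms(1)] deficit_def
    by (intro mult_left_mono sum_mono) auto
qed

lemma deficit_attained:
  fixes A :: "complex^'n^'n"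
  assumes "x \<in> torus"
  obtains u where "u \<in> torus" and "deficit A x =
    (norm (x - adjoint ((*v) A) u))\<^sup>2 + (real CARD('n) - (norm (adjoint ((*v) A) u))\<^sup>2)"
proof
  define u :: "complex^'n" where "u = (\<chi> i. if (A *v x) $ i = 0 then 1 else sgn ((A *v x) $ i))"
  show "u \<in> torus" by (simp add: u_def torus_def norm_sgn)
  have "inner ((A *v x) $ i) (u $ i) = cmod ((A *v x) $ i)" for i
    by (simp add: u_def sgn_div_norm power2_norm_eq_inner[symmetric] power2_eq_square)
  then show "deficit A x =
      (norm (x - adjoint ((*v) A) u))\<^sup>2 + (real CARD('n) - (norm (adjoint ((*v) A) u))\<^sup>2)"
    unfolding complete_square_adjoint[OF assms] deficit_def by simp
qed

lemma norm_rotation_mult_diff_le: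
  fixes x v :: "complex^'n"
  assumes "x \<in> torus"
  shows "(norm (rotation w j * x - v))\<^sup>2
    \<le> (norm (x - v))\<^sup>2 + cmod (w - 1) * (2 * cmod (x $ j - v $ j) + cmod (w - 1))"
proof -
  have "cmod (w * x $ j - x $ j) = cmod (w - 1)"
    using norm_mult[of "w - 1" "x $ j"] assms by (simp add: torus_def left_diff_distrib)
  then have "cmod (w * x $ j - v $ j) \<le> cmod (w - 1) + cmod (x $ j - v $ j)"
    using norm_triangle_ineq[of "w * x $ j - x $ j" "x $ j - v $ j"] by simp
  then have "(cmod (w * x $ j - v $ j))\<^sup>2 \<le> (cmod (w - 1) + cmod (x $ j - v $ j))\<^sup>2"
    by (intro power_mono) auto
  then have "(cmod (w * x $ j - v $ j))\<^sup>2
      \<le> (cmod (x $ j - v $ j))\<^sup>2 + cmod (w - 1) * (2 * cmod (x $ j - v $ j) + cmod (w - 1))"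
    by (simp add: power2_eq_square algebra_simps)
  moreover have "(\<Sum>i\<in>UNIV - {j}. (cmod ((rotation w j * x - v) $ i))\<^sup>2)
      = (\<Sum>i\<in>UNIV - {j}. (cmod ((x - v) $ i))\<^sup>2)"
    by (intro sum.cong) (auto simp: rotation_def)
  ultimately show ?thesis
    unfolding power2_norm_vec by (simp add: sum.remove[of UNIV j] rotation_def)
qed

text \<open>The bound keeps the \<open>u\<close> that is optimal for \<open>x\<close>; \<open>p j\<close> is the distance from the \<open>j\<close>-th
  coordinate of \<open>x\<close> to that of \<open>adjoint ((*v) A) u\<close>.\<close>

lemma deficit_rotation_le:
  fixes A :: "complex^'n^'n"
  assumes contraction: "onorm ((*v) A) \<le> 1" and x_torus: "x \<in> torus"
  obtains p :: "'n \<Rightarrow> real" where "\<And>j. 0 \<le> p j" and "(\<Sum>j\<in>UNIV. (p j)\<^sup>2) \<le> deficit A x"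
    and "\<And>j w. cmod w = 1 \<Longrightarrow>
      deficit A (rotation w j * x) \<le> deficit A x + cmod (w - 1) * (2 * p j + cmod (w - 1))"
proof -
  obtain u where u_torus: "u \<in> torus" and attained: "deficit A x =
      (norm (x - adjoint ((*v) A) u))\<^sup>2 + (real CARD('n) - (norm (adjoint ((*v) A) u))\<^sup>2)"
    by (rule deficit_attained[OF x_torus])
  define v where "v = adjoint ((*v) A) u"
  have "norm v \<le> norm u"
    unfolding v_def using contraction
    by (intro norm_adjoint_le norm_matrix_vector_mult_le bounded_linear.linear) auto
  then have norm_v_le: "(norm v)\<^sup>2 \<le> real CARD('n)"
    using power2_norm_torus[OF u_torus] power_mono[of "norm v" "norm u" 2] by simp
  show ?thesis
  proof (rule that[of "\<lambda>j. cmod (x $ j - v $ j)"])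
    show "(\<Sum>j\<in>UNIV. (cmod (x $ j - v $ j))\<^sup>2) \<le> deficit A x"
      using norm_v_le power2_norm_vec[of "x - v"] attained unfolding v_def by simp
    fix j and w :: complex
    assume "cmod w = 1"
    then show "deficit A (rotation w j * x)
        \<le> deficit A x + cmod (w - 1) * (2 * cmod (x $ j - v $ j) + cmod (w - 1))"
      using deficit_le[OF mult_mem_torus[OF rotation_mem_torus x_torus] u_torus, of w A j]
        norm_rotation_mult_diff_le[OF x_torus, of w j v] attained
      unfolding v_def by simp
  qed simp
qed

lemma deficit_nonneg:
  fixes A :: "complex^'n^'n"
  assumes "onorm ((*v) A) \<le> 1" and "x \<in> torus"
  shows "0 \<le> deficit A x"
proof -
  obtain p :: "'n \<Rightarrow> real" where "(\<Sum>j\<in>UNIV. (p j)\<^sup>2) \<le> deficit A x"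
    by (rule deficit_rotation_le[OF assms]) blast
  moreover have "0 \<le> (\<Sum>j\<in>UNIV. (p j)\<^sup>2)" by (simp add: sum_nonneg)
  ultimately show ?thesis by linarith
qed

lemma sqrt_diff_le_tangent:
  assumes "0 < a" and "0 \<le> b"
  shows "sqrt b - sqrt a \<le> (b - a) / (2 * sqrt a)"
proof -
  have "(sqrt b - sqrt a) * (2 * sqrt a) \<le> b - a"
    using assms zero_le_power2[of "sqrt b - sqrt a"]
    by (simp add: power2_diff left_diff_distrib mult.left_commute[of _ 2])
  then show ?thesis using assms(1) by (simp add: pos_le_divide_eq)
qed

lemma square_sqrt_increment_le:
  fixes G G' p t :: real
  assumes "0 \<le> G" and "0 \<le> G'" and "0 \<le> p" and "0 \<le> t" and increment: "G' \<le> G + t * (2 * p + t)"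
  shows "(max 0 (sqrt (G' + 1) - sqrt (G + 1)))\<^sup>2 \<le> t\<^sup>2 * (5 * (p\<^sup>2 + t\<^sup>2)) / (4 * (G + 1))"
proof -
  have "sqrt (G' + 1) - sqrt (G + 1) \<le> (G' - G) / (2 * sqrt (G + 1))"
    using sqrt_diff_le_tangent[of "G + 1" "G' + 1"] assms by simp
  also have "\<dots> \<le> t * (2 * p + t) / (2 * sqrt (G + 1))"
    using assms by (intro divide_right_mono) auto
  finally have "(max 0 (sqrt (G' + 1) - sqrt (G + 1)))\<^sup>2
      \<le> (t * (2 * p + t) / (2 * sqrt (G + 1)))\<^sup>2"
    using assms by (intro power_mono) auto
  also have "\<dots> = t\<^sup>2 * (2 * p + t)\<^sup>2 / (4 * (G + 1))"
    using assms by (simp add: power_mult_distrib power_divide)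
  also have "\<dots> \<le> t\<^sup>2 * (5 * (p\<^sup>2 + t\<^sup>2)) / (4 * (G + 1))"
    using zero_le_power2[of "p - 2 * t"] \<open>0 \<le> G\<close>
    by (intro divide_right_mono mult_left_mono) (auto simp: power2_eq_square algebra_simps)
  finally show ?thesis .
qed

definition root_deficit :: "complex^'n^'n \<Rightarrow> complex^'n \<Rightarrow> real" where
  "root_deficit A x = sqrt (deficit A x + 1)"

lemma root_deficit_gradient_le:
  fixes A :: "complex^'n^'n"
  assumes contraction: "onorm ((*v) A) \<le> 1" and x_torus: "x \<in> torus"
    and cmod_w: "cmod w = 1" and w_near_1: "real CARD('n) * (cmod (w - 1))\<^sup>2 \<le> 1"
  shows "(\<Sum>j\<in>UNIV. (max 0 (root_deficit A (rotation w j * x) - root_deficit A x))\<^sup>2)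
    \<le> 5 / 4 * (cmod (w - 1))\<^sup>2"
proof -
  define t where "t = cmod (w - 1)"
  define G where "G = deficit A x"
  obtain p where p_nonneg: "\<And>j. 0 \<le> p j" and sum_p_le: "(\<Sum>j\<in>UNIV. (p j)\<^sup>2) \<le> G"
    and increment: "\<And>j w. cmod w = 1 \<Longrightarrow>
      deficit A (rotation w j * x) \<le> G + cmod (w - 1) * (2 * p j + cmod (w - 1))"
    unfolding G_def by (rule deficit_rotation_le[OF contraction x_torus]) blast
  have G_nonneg: "0 \<le> G" unfolding G_def by (rule deficit_nonneg[OF contraction x_torus])
  have "0 \<le> deficit A (rotation w j * x)" for j
    by (intro deficit_nonneg[OF contraction] mult_mem_torus rotation_mem_torus cmod_w x_torus)
  then have "(max 0 (root_deficit A (rotation w j * x) - root_deficit A x))\<^sup>2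
      \<le> t\<^sup>2 * (5 * ((p j)\<^sup>2 + t\<^sup>2)) / (4 * (G + 1))" for j
    unfolding root_deficit_def G_def[symmetric] using increment[OF cmod_w] p_nonneg G_nonneg
    by (intro square_sqrt_increment_le) (simp_all add: t_def)
  then have "(\<Sum>j\<in>UNIV. (max 0 (root_deficit A (rotation w j * x) - root_deficit A x))\<^sup>2)
      \<le> (\<Sum>j\<in>UNIV. t\<^sup>2 * (5 * ((p j)\<^sup>2 + t\<^sup>2)) / (4 * (G + 1)))"
    by (rule sum_mono)
  also have "\<dots> = t\<^sup>2 * 5 * ((\<Sum>j\<in>UNIV. (p j)\<^sup>2) + real CARD('n) * t\<^sup>2) / (4 * (G + 1))"
    by (simp add: sum_divide_distrib[symmetric] sum_distrib_left[symmetric] sum.distrib)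
  also have "\<dots> \<le> t\<^sup>2 * 5 * (G + 1) / (4 * (G + 1))"
    using sum_p_le w_near_1 G_nonneg unfolding t_def
    by (intro divide_right_mono mult_left_mono add_mono) auto
  also have "\<dots> = 5 / 4 * t\<^sup>2" using G_nonneg by (simp add: divide_simps)
  finally show ?thesis unfolding t_def .
qed

section \<open>The mean of the deficit\<close>

lemma quarter_turns:
  fixes a b :: complex
  defines "P \<equiv> (cmod a)\<^sup>2 + (cmod b)\<^sup>2"
  obtains \<alpha> \<beta> where "\<alpha>\<^sup>2 + \<beta>\<^sup>2 = (cmod a)\<^sup>2 * (cmod b)\<^sup>2"
    and "\<And>F :: real \<Rightarrow> real. avg {..<4} (\<lambda>k. F ((cmod (a + \<i> ^ k * b))\<^sup>2)) =
      (F (P + 2 * \<alpha>) + F (P + 2 * \<beta>) + F (P - 2 * \<alpha>) + F (P - 2 * \<beta>)) / 4"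
proof
  let ?\<alpha> = "Re a * Re b + Im a * Im b" and ?\<beta> = "Im a * Re b - Re a * Im b"
  show "?\<alpha>\<^sup>2 + ?\<beta>\<^sup>2 = (cmod a)\<^sup>2 * (cmod b)\<^sup>2"
    unfolding cmod_power2 by (simp add: power2_eq_square algebra_simps)
  have "(cmod (a + b))\<^sup>2 = P + 2 * ?\<alpha>" "(cmod (a + \<i> * b))\<^sup>2 = P + 2 * ?\<beta>"
    "(cmod (a - b))\<^sup>2 = P - 2 * ?\<alpha>" "(cmod (a - \<i> * b))\<^sup>2 = P - 2 * ?\<beta>"
    unfolding P_def cmod_power2 by (simp_all add: power2_eq_square algebra_simps)
  then show "avg {..<4} (\<lambda>k. F ((cmod (a + \<i> ^ k * b))\<^sup>2)) =
      (F (P + 2 * ?\<alpha>) + F (P + 2 * ?\<beta>) + F (P - 2 * ?\<alpha>) + F (P - 2 * ?\<beta>)) / 4"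
    for F :: "real \<Rightarrow> real"
    by (simp add: avg_def eval_nat_numeral)
qed

lemma quarter_turns_moments:
  fixes a b :: complex
  shows "avg {..<4} (\<lambda>k. cmod (a + \<i> ^ k * b) ^ 2) = cmod a ^ 2 + cmod b ^ 2" (is ?second)
    and "avg {..<4} (\<lambda>k. cmod (a + \<i> ^ k * b) ^ 4)
      = cmod a ^ 4 + 4 * cmod b ^ 2 * cmod a ^ 2 + cmod b ^ 4" (is ?fourth)
    and "avg {..<4} (\<lambda>k. cmod (a + \<i> ^ k * b) ^ 6)
      = cmod a ^ 6 + 9 * cmod b ^ 2 * cmod a ^ 4 + 9 * cmod b ^ 4 * cmod a ^ 2 + cmod b ^ 6"
      (is ?sixth)
proof -
  define P where "P = (cmod a)\<^sup>2 + (cmod b)\<^sup>2"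
  obtain \<alpha> \<beta> where \<alpha>\<beta>: "\<alpha>\<^sup>2 + \<beta>\<^sup>2 = (cmod a)\<^sup>2 * (cmod b)\<^sup>2"
    and avg_eq: "\<And>F :: real \<Rightarrow> real. avg {..<4} (\<lambda>k. F ((cmod (a + \<i> ^ k * b))\<^sup>2)) =
      (F (P + 2 * \<alpha>) + F (P + 2 * \<beta>) + F (P - 2 * \<alpha>) + F (P - 2 * \<beta>)) / 4"
    unfolding P_def by (rule quarter_turns[of a b]) blast
  have even_powers: "r ^ 4 = (r\<^sup>2)\<^sup>2" "r ^ 6 = (r\<^sup>2) ^ 3" for r :: real
    by (simp_all flip: power_mult)
  show ?second using avg_eq[of "\<lambda>s. s"] by (simp add: P_def)
  have "avg {..<4} (\<lambda>k. cmod (a + \<i> ^ k * b) ^ 4) = P\<^sup>2 + 2 * (\<alpha>\<^sup>2 + \<beta>\<^sup>2)"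
    unfolding even_powers avg_eq[of "\<lambda>s. s\<^sup>2"] by (simp add: power2_eq_square algebra_simps)
  then show ?fourth
    unfolding \<alpha>\<beta> even_powers P_def by (simp add: power2_eq_square algebra_simps)
  have "avg {..<4} (\<lambda>k. cmod (a + \<i> ^ k * b) ^ 6) = P ^ 3 + 6 * P * (\<alpha>\<^sup>2 + \<beta>\<^sup>2)"
    unfolding even_powers avg_eq[of "\<lambda>s. s ^ 3"]
    by (simp add: power2_eq_square power3_eq_cube algebra_simps)
  then show ?sixth
    unfolding \<alpha>\<beta> even_powers P_def by (simp add: power2_eq_square power3_eq_cube algebra_simps)
qed

definition linear_form :: "complex^'n \<Rightarrow> 'n set \<Rightarrow> complex^'n \<Rightarrow> complex" where
  "linear_form c S x = (\<Sum>j\<in>S. c $ j * x $ j)"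

lemma avg_root_grid_quarter_turns:
  fixes f :: "complex^'n \<Rightarrow> real"
  assumes "m > 0" "4 dvd m"
  shows "avg (root_grid m) f
    = avg (root_grid m) (\<lambda>x. avg {..<4} (\<lambda>k. f (rotation (\<i> ^ k) j * x)))"
proof -
  have "(\<i> ^ k) ^ m = 1" for k
  proof -
    obtain d where "m = 4 * d" using assms(2) by blast
    then have "(\<i> ^ k) ^ m = ((\<i> ^ 4) ^ d) ^ k" by (simp only: power_mult[symmetric] mult_ac)
    then show ?thesis by simp
  qed
  then have "avg (root_grid m) (\<lambda>x. f (rotation (\<i> ^ k) j * x)) = avg (root_grid m) f" for k
    using assms(1) by (intro avg_bij_betw bij_betw_root_grid_mult rotation_mem_root_grid) auto
  then show ?thesis by (subst avg_swap) (simp add: avg_const lessThan_empty_iff)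
qed

definition linear_form_moment :: "nat \<Rightarrow> complex^'n \<Rightarrow> 'n set \<Rightarrow> nat \<Rightarrow> real" where
  "linear_form_moment m c S d = avg (root_grid m) (\<lambda>x. cmod (linear_form c S x) ^ d)"

lemma linear_form_moment_insert_eq_quarter_turns:
  fixes c :: "complex^'n"
  assumes four_dvd_m: "m > 0" "4 dvd m" and "j \<notin> S"
  shows "linear_form_moment m c (insert j S) d = avg (root_grid m)
    (\<lambda>x. avg {..<4} (\<lambda>k. cmod (linear_form c S x + \<i> ^ k * (c $ j * x $ j)) ^ d))"
proof -
  have "linear_form c (insert j S) (rotation w j * x) = linear_form c S x + w * (c $ j * x $ j)"
    for w x
  proof -
    have "linear_form c S (rotation w j * x) = linear_form c S x"
      unfolding linear_form_def using \<open>j \<notin> S\<close> by (intro sum.cong) (auto simp: rotation_def)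
    then show ?thesis using \<open>j \<notin> S\<close> by (simp add: linear_form_def rotation_def mult_ac)
  qed
  then show ?thesis
    unfolding linear_form_moment_def
    by (subst avg_root_grid_quarter_turns[OF four_dvd_m, of _ j]) simp
qed

lemma linear_form_moment_insert:
  fixes c :: "complex^'n"
  assumes four_dvd_m: "m > 0" "4 dvd m" and "j \<notin> S"
  defines "M \<equiv> linear_form_moment m c" and "r \<equiv> cmod (c $ j)"
  shows "M (insert j S) 2 = M S 2 + r ^ 2" (is ?second)
    and "M (insert j S) 4 = M S 4 + 4 * r ^ 2 * M S 2 + r ^ 4" (is ?fourth)
    and "M (insert j S) 6 = M S 6 + 9 * r ^ 2 * M S 4 + 9 * r ^ 4 * M S 2 + r ^ 6" (is ?sixth)
proof -
  have unimodular: "cmod (x $ j) = 1" if "x \<in> root_grid m" for x :: "complex^'n"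
    using that root_grid_subset_torus[OF four_dvd_m(1)] by (auto simp: torus_def)
  note quarter_turns_average =
    linear_form_moment_insert_eq_quarter_turns[OF four_dvd_m \<open>j \<notin> S\<close>]
    quarter_turns_moments norm_mult unimodular
  note avg_simps = avg_add avg_cmult avg_root_grid_const[OF four_dvd_m(1)]
  show ?second ?fourth ?sixth
    by (simp_all add: M_def r_def quarter_turns_average avg_simps cong: avg_cong
        flip: linear_form_moment_def)
qed

lemma linear_form_moments:
  fixes c :: "complex^'n"
  assumes four_dvd_m: "m > 0" "4 dvd m"
  defines "M \<equiv> linear_form_moment m c" and "p \<equiv> \<lambda>S d. \<Sum>j\<in>S. cmod (c $ j) ^ d"
  shows "M S 2 = p S 2" (is ?second) and "M S 4 = 2 * (p S 2)\<^sup>2 - p S 4" (is ?fourth)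
    and "M S 6 = 6 * (p S 2) ^ 3 - 9 * p S 2 * p S 4 + 4 * p S 6" (is ?sixth)
proof -
  have "?second \<and> ?fourth \<and> ?sixth"
    using finite[of S]
  proof (induction S rule: finite_induct)
    case empty
    then show ?case by (simp add: M_def linear_form_moment_def linear_form_def avg_def p_def)
  next
    case (insert j S)
    then have p_insert: "p (insert j S) d = p S d + cmod (c $ j) ^ d" for d by (simp add: p_def)
    show ?case
      by (simp only: p_insert insert.IH
          linear_form_moment_insert[OF four_dvd_m insert.hyps(2), of c, folded M_def])
        (simp add: eval_nat_numeral algebra_simps)
  qed
  then show ?second ?fourth ?sixth by auto
qed

text \<open>The right-hand side involves only even powers of \<open>t\<close>, hence explicit moments, and touches
  \<open>36 * t\<close> at \<open>t = 1\<close>, the modulus of every value of a linear form with a single coefficient of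
  modulus \<open>1\<close>.\<close>

lemma le_even_sextic: "36 * t \<le> t ^ 6 - 7 * t ^ 4 + 29 * t\<^sup>2 + (13 :: real)"
proof -
  have "t ^ 6 - 7 * t ^ 4 + 29 * t\<^sup>2 + 13 - 36 * t = (t - 1)\<^sup>2 * ((t\<^sup>2 + t - 3)\<^sup>2 + (t - 2)\<^sup>2)"
    by (simp add: eval_nat_numeral algebra_simps)
  moreover have "0 \<le> (t - 1)\<^sup>2 * ((t\<^sup>2 + t - 3)\<^sup>2 + (t - 2)\<^sup>2)" by simp
  ultimately show ?thesis by linarith
qed

lemma sum_power4_le_if_norm_eq_1:
  fixes c :: "'a::real_normed_vector^'n"
  assumes "norm c = 1" and "\<And>j. norm (c $ j) \<le> b"
  shows "(\<Sum>j\<in>UNIV. norm (c $ j) ^ 4) \<le> b"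
proof -
  have "norm (c $ j) ^ 4 \<le> b * norm (c $ j) ^ 2" for j
  proof -
    have "norm (c $ j) * norm (c $ j) ^ 3 \<le> b * norm (c $ j) ^ 2"
      using Finite_Cartesian_Product.norm_nth_le[of c j] assms
      by (intro mult_mono' power_decreasing) auto
    then show ?thesis by (simp add: eval_nat_numeral)
  qed
  then have "(\<Sum>j\<in>UNIV. norm (c $ j) ^ 4) \<le> (\<Sum>j\<in>UNIV. b * norm (c $ j) ^ 2)"
    by (rule sum_mono)
  also have "\<dots> = b" using power2_norm_vec[of c] assms(1) by (simp flip: sum_distrib_left)
  finally show ?thesis .
qed

lemma linear_form_first_moment_le_if_norm_eq_1:
  fixes c :: "complex^'n"
  assumes four_dvd_m: "m > 0" "4 dvd m" and unit: "norm c = 1"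
    and entries_le: "\<And>j. cmod (c $ j) \<le> b"
  shows "avg (root_grid m) (\<lambda>x. cmod (linear_form c UNIV x)) \<le> 17 / 18 + b / 18"
proof -
  let ?X = "root_grid m :: (complex^'n) set" and ?y = "\<lambda>x. cmod (linear_form c UNIV x)"
  let ?p = "\<lambda>d. \<Sum>j\<in>UNIV. cmod (c $ j) ^ d"
  have sum_squares_eq_1: "?p 2 = 1" using power2_norm_vec[of c] unit by simp
  have "cmod (c $ j) ^ 6 \<le> cmod (c $ j) ^ 4" for j
    using Finite_Cartesian_Product.norm_nth_le[of c j] unit by (intro power_decreasing) auto
  then have sixth_le_fourth: "?p 6 \<le> ?p 4" by (rule sum_mono)
  have "36 * avg ?X ?y \<le> avg ?X (\<lambda>x. ?y x ^ 6 - 7 * ?y x ^ 4 + 29 * ?y x ^ 2 + 13)"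
    unfolding avg_cmult[symmetric] by (intro avg_mono le_even_sextic)
  also have "\<dots> = (6 - 9 * ?p 4 + 4 * ?p 6) - 7 * (2 - ?p 4) + 29 + 13"
    by (simp add: avg_add avg_diff avg_cmult linear_form_moments[OF four_dvd_m] 
        sum_squares_eq_1 avg_root_grid_const[OF four_dvd_m(1)] flip: linear_form_moment_def)
  also have "\<dots> \<le> 34 + 2 * b"
    using sixth_le_fourth sum_power4_le_if_norm_eq_1[OF unit entries_le] by simp
  finally show ?thesis by simp
qed

lemma linear_form_first_moment_le:
  fixes c :: "complex^'n"
  assumes four_dvd_m: "m > 0" "4 dvd m" and "norm c \<le> 1" and entries_le: "\<And>j. cmod (c $ j) \<le> a"
  shows "avg (root_grid m) (\<lambda>x. cmod (linear_form c UNIV x)) \<le> 17 / 18 + a / 18"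
proof (cases "c = 0")
  case True
  have "0 \<le> a" using order_trans[OF norm_ge_zero entries_le] .
  then show ?thesis using True by (simp add: linear_form_def avg_def)
next
  case False
  define r where "r = norm c"
  have r_bounds: "0 < r" "r \<le> 1" using False assms(3) by (auto simp: r_def)
  have "c = r *\<^sub>R sgn c" using r_bounds by (simp add: sgn_div_norm r_def)
  then have sgn_component: "c $ j = of_real r * sgn c $ j" for j
    by (metis scaleR_conv_of_real vector_scaleR_component)
  then have "linear_form c UNIV x = of_real r * linear_form (sgn c) UNIV x" for x
    by (simp add: linear_form_def sum_distrib_left mult.assoc)
  then have "avg (root_grid m) (\<lambda>x. cmod (linear_form c UNIV x))
      = r * avg (root_grid m) (\<lambda>x. cmod (linear_form (sgn c) UNIV x))"
    using r_bounds by (simp add: norm_mult avg_cmult)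
  also have "\<dots> \<le> r * (17 / 18 + a / r / 18)"
  proof (intro mult_left_mono linear_form_first_moment_le_if_norm_eq_1[OF four_dvd_m])
    show "norm (sgn c) = 1" using False by (simp add: norm_sgn)
    show "cmod (sgn c $ j) \<le> a / r" for j
      using entries_le[of j] r_bounds by (simp add: sgn_component norm_mult field_simps)
  qed (use r_bounds in simp)
  also have "\<dots> \<le> 17 / 18 + a / 18" using r_bounds by (simp add: distrib_left)
  finally show ?thesis .
qed

lemma norm_row_le_onorm:
  fixes A :: "complex^'n^'m"
  shows "norm (row i A) \<le> onorm ((*v) A)"
proof (cases "row i A = 0")
  case True
  then show ?thesis by (simp add: onorm_pos_le)
next
  case False
  define x where "x = (\<chi> j. cnj (A $ i $ j))"
  have norm_x: "norm x = norm (row i A)" by (simp add: x_def row_def norm_vec_def L2_set_def)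
  have "(A *v x) $ i = of_real ((norm (row i A))\<^sup>2)"
    by (simp add: matrix_vector_mult_def x_def row_def power2_norm_vec flip: complex_norm_square)
  then have "(norm (row i A))\<^sup>2 = cmod ((A *v x) $ i)" by (simp only: norm_of_real) simp
  also have "\<dots> \<le> norm (A *v x)" by (rule Finite_Cartesian_Product.norm_nth_le)
  also have "\<dots> \<le> onorm ((*v) A) * norm (row i A)"
    unfolding norm_x[symmetric] by (intro onorm) simp
  finally show ?thesis using False by (simp add: power2_eq_square)
qed

theorem avg_deficit_ge:
  fixes A :: "complex^'n^'n"
  assumes four_dvd_m: "m > 0" "4 dvd m" and contraction: "onorm ((*v) A) \<le> 1"
    and entries_le: "\<And>i j. cmod (A $ i $ j) \<le> a i"
  shows "(\<Sum>i\<in>UNIV. 1 - a i) / 9 \<le> avg (root_grid m) (deficit A)"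
proof -
  have "(\<Sum>i\<in>UNIV. 1 - a i) / 9 = 2 * (\<Sum>i\<in>UNIV. 1 - (17 / 18 + a i / 18))"
    unfolding sum_divide_distrib sum_distrib_left by (intro sum.cong) (simp_all add: field_simps)
  also have "\<dots> \<le> 2 * (\<Sum>i\<in>UNIV. 1 - avg (root_grid m) (\<lambda>x. cmod ((A *v x) $ i)))"
  proof (intro mult_left_mono sum_mono diff_left_mono)
    fix i
    have "norm (row i A) \<le> 1" using norm_row_le_onorm[of i A] contraction by simp
    then have "avg (root_grid m) (\<lambda>x. cmod (linear_form (row i A) UNIV x)) \<le> 17 / 18 + a i / 18"
      using entries_le by (intro linear_form_first_moment_le[OF four_dvd_m])
        (simp_all add: row_def)
    then show "avg (root_grid m) (\<lambda>x. cmod ((A *v x) $ i)) \<le> 17 / 18 + a i / 18"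
      by (simp add: linear_form_def row_def matrix_vector_mult_def)
  qed simp
  also have "\<dots> = avg (root_grid m) (deficit A)"
    by (simp add: deficit_def[abs_def] avg_cmult avg_sum avg_diff
        avg_root_grid_const[OF four_dvd_m(1)])
  finally show ?thesis .
qed

section \<open>The permanent of a contraction\<close>

lemma cmod_perm_le_avg_exp_deficit:
  fixes A :: "complex^'n^'n"
  assumes m_gt_1: "m > 1"
  shows "cmod (perm A) \<le> avg (root_grid m) (\<lambda>x. exp (- deficit A x / 2))"
proof -
  have "cmod (perm A)
      \<le> avg (root_grid m) (\<lambda>x. cmod ((\<Prod>j\<in>UNIV. cnj (x $ j)) * (\<Prod>i\<in>UNIV. (A *v x) $ i)))"
    unfolding glynn_formula[OF m_gt_1] by (rule norm_avg_le)
  also have "\<dots> \<le> avg (root_grid m) (\<lambda>x. exp (- deficit A x / 2))"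
  proof (rule avg_mono)
    fix x :: "complex^'n"
    assume "x \<in> root_grid m"
    then have "cmod (x $ j) = 1" for j
      using root_grid_subset_torus[of m] m_gt_1 by (auto simp: torus_def)
    then have "cmod ((\<Prod>j\<in>UNIV. cnj (x $ j)) * (\<Prod>i\<in>UNIV. (A *v x) $ i))
        = (\<Prod>i\<in>UNIV. cmod ((A *v x) $ i))"
      by (simp add: norm_mult flip: prod_norm)
    also have "\<dots> \<le> (\<Prod>i\<in>UNIV. exp (cmod ((A *v x) $ i) - 1))"
      using exp_ge_add_one_self[of "cmod ((A *v x) $ _) - 1"] by (intro prod_mono) auto
    also have "\<dots> = exp (- deficit A x / 2)"
      by (simp add: deficit_def sum_subtractf flip: exp_sum)
    finally show "cmod ((\<Prod>j\<in>UNIV. cnj (x $ j)) * (\<Prod>i\<in>UNIV. (A *v x) $ i))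
      \<le> exp (- deficit A x / 2)" .
  qed
  finally show ?thesis .
qed

context
  fixes A :: "complex^'n^'n" and m :: nat
  assumes contraction: "onorm ((*v) A) \<le> 1" and m_ge: "m \<ge> 8 * CARD('n)"
begin

private lemma order_pos: "m > 0"
  using m_ge zero_less_card_finite[where 'a = 'n] by linarith

interpretation commuting_cyclic_maps "root_grid m :: (complex^'n) set"
    "\<lambda>j. (*) (rotation (unity_root m) j)" m
  by (rule commuting_cyclic_maps_root_grid[OF order_pos])

private lemma root_deficit_nonneg: "x \<in> root_grid m \<Longrightarrow> 0 \<le> root_deficit A x"
  and root_deficit_square: "x \<in> root_grid m \<Longrightarrow> (root_deficit A x)\<^sup>2 = deficit A x + 1"
  using deficit_nonneg[OF contraction, of x] root_grid_subset_torus[OF order_pos]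
  by (auto simp: root_deficit_def)

private lemma upward_gradient_square_root_deficit_le:
  assumes "x \<in> root_grid m"
  shows "(real m)\<^sup>2 / 3 * upward_gradient_square (root_deficit A) x \<le> 160 / 3"
proof -
  define t where "t = cmod (unity_root m - 1)"
  have x_torus: "x \<in> torus" using assms root_grid_subset_torus[OF order_pos] by blast
  have "real m * t \<le> 8"
    unfolding t_def using mult_cmod_unity_root_minus_1_le[of m] pi_less_4 by simp
  then have m_times_t_le: "(real m * t)\<^sup>2 \<le> 8\<^sup>2" by (intro power_mono) (auto simp: t_def)
  have "64 * real CARD('n) \<le> (8 * real CARD('n))\<^sup>2"
    using mult_right_mono[of 1 "real CARD('n)" "real CARD('n)"]
    by (simp add: power2_eq_square Suc_leI)
  also have "\<dots> \<le> (real m)\<^sup>2" using m_ge by (intro power_mono) linarith+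
  finally have "64 * real CARD('n) * t\<^sup>2 \<le> (real m)\<^sup>2 * t\<^sup>2" by (rule mult_right_mono) simp
  then have t_small: "real CARD('n) * t\<^sup>2 \<le> 1"
    using m_times_t_le by (simp add: power_mult_distrib)
  have inverse_rotation:
    "((*) (rotation (unity_root m) j) ^^ (m - 1)) x = rotation (cnj (unity_root m)) j * x" for j
    by (simp only: funpow_times_power[of "\<lambda>_. m - 1"] power_rotation
        unity_root_power_pred[OF order_pos])
  have cnj_dist: "cmod (cnj (unity_root m) - 1) = t"
    using complex_mod_cnj[of "unity_root m - 1"] by (simp add: t_def)
  have "upward_gradient_square (root_deficit A) x \<le> 5 / 4 * t\<^sup>2 + 5 / 4 * t\<^sup>2"
    unfolding upward_gradient_square_def sum.distrib inverse_rotation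
    using root_deficit_gradient_le[OF contraction x_torus, of "unity_root m"] t_small cnj_dist
      root_deficit_gradient_le[OF contraction x_torus, of "cnj (unity_root m)"]
      cmod_unity_root[of m]
    by (intro add_mono) (simp_all add: t_def)
  then have "(real m)\<^sup>2 / 3 * upward_gradient_square (root_deficit A) x
      \<le> (real m)\<^sup>2 / 3 * (5 / 2 * t\<^sup>2)"
    by (intro mult_left_mono) auto
  also have "\<dots> = 5 / 6 * (real m * t)\<^sup>2" by (simp add: power_mult_distrib)
  also have "\<dots> \<le> 160 / 3" using m_times_t_le by simp
  finally show ?thesis .
qed

lemma sqrt_avg_deficit_le:
  "sqrt (avg (root_grid m) (deficit A)) \<le> avg (root_grid m) (root_deficit A) + 22 / 3"
proof -
  have "avg (root_grid m) (deficit A) \<le> avg (root_grid m) (\<lambda>x. (root_deficit A x)\<^sup>2)"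
    by (rule avg_mono) (simp add: root_deficit_square)
  then have "sqrt (avg (root_grid m) (deficit A))
      \<le> sqrt (avg (root_grid m) (\<lambda>x. (root_deficit A x)\<^sup>2))"
    by (rule real_sqrt_le_mono)
  also have "\<dots> \<le> avg (root_grid m) (root_deficit A) + 22 / 3"
    using variance_le[OF upward_gradient_square_root_deficit_le]
    by (intro root_mean_square_le_avg_plus root_deficit_nonneg) (auto simp: power2_eq_square)
  finally show ?thesis .
qed

lemma avg_exp_deficit_le:
  assumes "0 < l" and "80 * l\<^sup>2 \<le> 3"
  shows "avg (root_grid m) (\<lambda>x. exp (- deficit A x / 2))
    \<le> exp (1 / 2 + 54 * l\<^sup>2 - l * avg (root_grid m) (root_deficit A))"
proof -
  have "avg (root_grid m) (\<lambda>x. exp (- deficit A x / 2))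
      \<le> avg (root_grid m) (\<lambda>x. exp (1 / 2 + l\<^sup>2 / 2) * exp (- l * root_deficit A x))"
  proof (rule avg_mono)
    fix x :: "complex^'n"
    assume "x \<in> root_grid m"
    then have "- deficit A x / 2 \<le> 1 / 2 + l\<^sup>2 / 2 + - l * root_deficit A x"
      using zero_le_power2[of "root_deficit A x - l"] root_deficit_square[of x]
      by (simp add: power2_diff field_simps)
    then show "exp (- deficit A x / 2) \<le> exp (1 / 2 + l\<^sup>2 / 2) * exp (- l * root_deficit A x)"
      by (simp flip: exp_add)
  qed
  also have "\<dots> \<le> exp (1 / 2 + l\<^sup>2 / 2)
      * exp (- l * avg (root_grid m) (root_deficit A) + 160 / 3 * l\<^sup>2)"
    unfolding avg_cmult using assms
    by (intro mult_left_mono avg_exp_le upward_gradient_square_root_deficit_le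
        root_deficit_nonneg) auto
  also have "\<dots> \<le> exp (1 / 2 + 54 * l\<^sup>2 - l * avg (root_grid m) (root_deficit A))"
    by (simp flip: exp_add)
  finally show ?thesis .
qed

end

theorem cmod_perm_contraction_le:
  fixes A :: "complex^'n^'n"
  assumes contraction: "onorm ((*v) A) \<le> 1" and entries_le: "\<And>i j. cmod (A $ i $ j) \<le> a i"
  shows "cmod (perm A) \<le> exp (1 - sqrt (\<Sum>i\<in>UNIV. 1 - a i) / 72)"
proof -
  define m where "m = 8 * CARD('n)"
  have m_props: "m > 1" "m > 0" "4 dvd m" "8 * CARD('n) \<le> m" by (auto simp: m_def Suc_lessI)
  have "sqrt (\<Sum>i\<in>UNIV. 1 - a i) / 3 = sqrt ((\<Sum>i\<in>UNIV. 1 - a i) / 9)"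
    by (simp add: real_sqrt_divide)
  also have "\<dots> \<le> sqrt (avg (root_grid m) (deficit A))"
    by (intro real_sqrt_le_mono avg_deficit_ge[OF m_props(2,3) contraction entries_le])
  also have "\<dots> \<le> avg (root_grid m) (root_deficit A) + 22 / 3"
    by (rule sqrt_avg_deficit_le[OF contraction m_props(4)])
  finally have mean: "sqrt (\<Sum>i\<in>UNIV. 1 - a i) / 3 \<le> avg (root_grid m) (root_deficit A) + 22 / 3" .
  have "cmod (perm A) \<le> avg (root_grid m) (\<lambda>x. exp (- deficit A x / 2))"
    by (rule cmod_perm_le_avg_exp_deficit[OF m_props(1)])
  also have "\<dots> \<le> exp (1 / 2 + 54 * (1 / 24)\<^sup>2 - 1 / 24 * avg (root_grid m) (root_deficit A))"
    by (intro avg_exp_deficit_le[OF contraction m_props(4)]) (auto simp: power2_eq_square)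
  also have "\<dots> \<le> exp (1 - sqrt (\<Sum>i\<in>UNIV. 1 - a i) / 72)"
    using mean by (simp add: power2_eq_square)
  finally show ?thesis .
qed

section \<open>Real matrices\<close>

lemma onorm_map_matrix_complex_of_real_le:
  fixes A :: "real^'n^'m"
  shows "onorm ((*v) (map_matrix complex_of_real A)) \<le> onorm ((*v) A)"
proof (rule onorm_bound)
  show "0 \<le> onorm ((*v) A)" by (intro onorm_pos_le) simp
  fix x :: "complex^'n"
  define re im where "re = (\<chi> j. Re (x $ j))" and "im = (\<chi> j. Im (x $ j))"
  have "(norm (map_matrix complex_of_real A *v x))\<^sup>2 = (norm (A *v re))\<^sup>2 + (norm (A *v im))\<^sup>2"
    by (simp add: power2_norm_vec cmod_power2 matrix_vector_mult_def re_def im_def sum.distrib)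
  also have "\<dots> \<le> (onorm ((*v) A) * norm re)\<^sup>2 + (onorm ((*v) A) * norm im)\<^sup>2"
    by (intro add_mono power_mono onorm) auto
  also have "\<dots> = (onorm ((*v) A))\<^sup>2 * ((norm re)\<^sup>2 + (norm im)\<^sup>2)"
    by (simp add: power_mult_distrib distrib_left)
  also have "(norm re)\<^sup>2 + (norm im)\<^sup>2 = (norm x)\<^sup>2"
    by (simp add: power2_norm_vec cmod_power2 re_def im_def sum.distrib)
  finally show "norm (map_matrix complex_of_real A *v x) \<le> onorm ((*v) A) * norm x"
    using \<open>0 \<le> onorm ((*v) A)\<close> by (simp flip: power_mult_distrib add: power2_le_iff_abs_le)
qed

lemma perm_map_matrix_of_real:
  "perm (map_matrix of_real A) = (of_real (perm A) :: 'a::{real_algebra_1,comm_ring_1})"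
  by (simp add: perm_def)

lemma perm_scaleR:
  fixes A :: "real^'n^'n"
  shows "perm (c *\<^sub>R A) = c ^ CARD('n) * perm A"
  by (simp add: perm_def prod.distrib sum_distrib_left)

lemma h_inf_scaleR: "h_inf (c *\<^sub>R A) = \<bar>c\<bar> * h_inf A"
proof -
  have "row i (c *\<^sub>R A) = c *\<^sub>R row i A" for i by (simp add: vec_eq_iff row_def)
  then show ?thesis by (simp add: h_inf_def infnorm_mul sum_distrib_left)
qed

lemma infnorm_row_le_onorm:
  fixes A :: "real^'n^'m"
  shows "infnorm (row i A) \<le> onorm ((*v) A)"
  unfolding infnorm_cart by (rule cSup_least) (auto simp: row_def matrix_component_le_onorm)

theorem perm_contraction_le:
  fixes A :: "real^'n^'n"
  assumes contraction: "onorm ((*v) A) \<le> 1"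
  shows "\<bar>perm A\<bar> \<le> exp (1 - sqrt (real CARD('n) * (1 - h_inf A)) / 72)"
proof -
  have "\<bar>perm A\<bar> = cmod (perm (map_matrix complex_of_real A))"
    by (simp add: perm_map_matrix_of_real)
  also have "\<dots> \<le> exp (1 - sqrt (\<Sum>i\<in>UNIV. 1 - infnorm (row i A)) / 72)"
  proof (rule cmod_perm_contraction_le)
    show "onorm ((*v) (map_matrix complex_of_real A)) \<le> 1"
      using onorm_map_matrix_complex_of_real_le[of A] contraction by simp
    show "cmod (map_matrix complex_of_real A $ i $ j) \<le> infnorm (row i A)" for i j
      using component_le_infnorm_cart[of "row i A" j] by (simp add: row_def)
  qed
  also have "(\<Sum>i\<in>UNIV. 1 - infnorm (row i A)) = real CARD('n) * (1 - h_inf A)"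
    by (simp add: h_inf_def sum_subtractf right_diff_distrib)
  finally show ?thesis .
qed

lemma h_inf_le_onorm: "h_inf A \<le> onorm ((*v) A)"
proof -
  have "(\<Sum>i\<in>UNIV. infnorm (row i A)) \<le> real CARD('a) * onorm ((*v) A)"
    using infnorm_row_le_onorm[of _ A] by (intro sum_bounded_above) auto
  then show ?thesis by (simp add: h_inf_def field_simps)
qed

theorem theorem3:
  fixes A :: "real^'n^'n" and T :: real
  assumes "T > 0"
    and "onorm (\<lambda>x. A *v x) \<le> T"
  shows "\<bar>perm A\<bar> \<le> T ^ CARD('n) * (real CARD('n) + 6) *
    exp (- sqrt (real CARD('n) * (1 - h_inf A / T)) / 400)"
proof -
  define B where "B = (1 / T) *\<^sub>R A"
  define s where "s = sqrt (real CARD('n) * (1 - h_inf B))"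
  have "onorm ((*v) B) = onorm (\<lambda>x. (1 / T) *\<^sub>R (A *v x))"
    by (simp add: B_def scaleR_matrix_vector_assoc)
  then have B_contraction: "onorm ((*v) B) \<le> 1" using assms by (simp add: onorm_scaleR)
  have "\<bar>perm B\<bar> \<le> exp 1 * exp (- s / 72)"
    using perm_contraction_le[OF B_contraction] unfolding s_def by (simp flip: exp_add)
  also have "\<dots> \<le> (real CARD('n) + 6) * exp (- s / 400)"
  proof (intro mult_mono)
    show "exp 1 \<le> real CARD('n) + 6" using exp_le by simp
    show "exp (- s / 72) \<le> exp (- s / 400)"
      using h_inf_le_onorm[of B] B_contraction by (simp add: s_def)
  qed auto
  finally have "T ^ CARD('n) * \<bar>perm B\<bar> \<le> T ^ CARD('n) * ((real CARD('n) + 6) * exp (- s / 400))"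
    using assms(1) by (intro mult_left_mono) auto
  moreover have "A = T *\<^sub>R B" using assms(1) by (simp add: B_def)
  ultimately show ?thesis
    using assms(1) by (simp add: perm_scaleR h_inf_scaleR abs_mult s_def mult.assoc)
qed

end
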